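(* Let $\Gamma$ be a strongly regular graph with $\Gamma_2\cong\Gamma$. Then $\Gamma$ is self-complementary and has parameters $(v,k,\lambda,\mu)=(4t+1,2t,t-1,t)$ for some positive integer $t$, and the number of vertices $4t+1$ is a sum of two squares.
   Context: For a finite simple graph $\Gamma$ with path-distance $d$, $\Gamma_2$ is the graph on $V(\Gamma)$ with $u,v$ adjacent iff $d(u,v)=2$. A graph on $v$ vertices is strongly regular with parameters $(v,k,\lambda,\mu)$ if it is $k$-regular, every two adjacent vertices have exactly $\lambda$ common neighbours and every two distinct non-adjacent vertices have exactly $\mu$ common neighbours; as is standard, a strongly regular graph is assumed to be neither complete nor edgeless. *)

theory Defs
  imports "Graph_Theory.Graph_Theory"
begin

text \<open>
  Finite simple graphs are those \<^typ>\<open>'a pair_pre_digraph\<close>s that satisfy \<^const>\<open>pair_graph\<close>: finite,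
  loop-free, with a symmetric set of arcs, an edge being represented by its two opposite arcs.
\<close>

definition graph_dist :: "'a pair_pre_digraph \<Rightarrow> 'a \<Rightarrow> 'a \<Rightarrow> ereal" where
  "graph_dist G u v = wf_digraph.\<mu> (with_proj G) (\<lambda>_. 1) u v"

definition dist2_graph :: "'a pair_pre_digraph \<Rightarrow> 'a pair_pre_digraph" where
  "dist2_graph G = \<lparr> pverts = pverts G,
     parcs = {(u, v). u \<in> pverts G \<and> v \<in> pverts G \<and> graph_dist G u v = 2} \<rparr>"

definition graph_complement :: "'a pair_pre_digraph \<Rightarrow> 'a pair_pre_digraph" where
  "graph_complement G = \<lparr> pverts = pverts G,
     parcs = {(u, v). u \<in> pverts G \<and> v \<in> pverts G \<and> u \<noteq> v \<and> (u, v) \<notin> parcs G} \<rparr>"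

definition graph_iso :: "'a pair_pre_digraph \<Rightarrow> 'b pair_pre_digraph \<Rightarrow> bool" where
  "graph_iso G H \<longleftrightarrow> digraph_iso (with_proj G) (with_proj H)"

definition self_complementary :: "'a pair_pre_digraph \<Rightarrow> bool" where
  "self_complementary G \<longleftrightarrow> graph_iso G (graph_complement G)"

definition neighbours :: "'a pair_pre_digraph \<Rightarrow> 'a \<Rightarrow> 'a set" where
  "neighbours G u = {w. (u, w) \<in> parcs G}"

definition strongly_regular ::
    "'a pair_pre_digraph \<Rightarrow> nat \<Rightarrow> nat \<Rightarrow> nat \<Rightarrow> nat \<Rightarrow> bool" where
  "strongly_regular G n k l m \<longleftrightarrow>
     pair_graph G \<and>
     card (pverts G) = n \<and>
     (\<forall>u \<in> pverts G. card (neighbours G u) = k) \<and>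
     (\<forall>u \<in> pverts G. \<forall>v \<in> pverts G. (u, v) \<in> parcs G \<longrightarrow>
        card (neighbours G u \<inter> neighbours G v) = l) \<and>
     (\<forall>u \<in> pverts G. \<forall>v \<in> pverts G. u \<noteq> v \<and> (u, v) \<notin> parcs G \<longrightarrow>
        card (neighbours G u \<inter> neighbours G v) = m) \<and>
     parcs G \<noteq> {} \<and>
     \<not> complete_digraph n (with_proj G)"

end

theory Submission
  imports Defs "HOL-Computational_Algebra.Primes"
begin

text \<open>
  Since \<open>\<Gamma>\<close> has edges, \<open>\<Gamma>\<^sub>2 \<cong> \<Gamma>\<close> forces \<open>\<mu> > 0\<close>, so that \<open>\<Gamma>\<^sub>2\<close> is the complement of \<open>\<Gamma>\<close>.
  Comparing the parameters of a strongly regular graph with those of its complement gives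
  \<open>(4t + 1, 2t, t - 1, t)\<close>.

  For such parameters the bordered Seidel matrix \<open>C\<close> of order \<open>4t + 2\<close> satisfies
  \<open>\<parallel>C x\<parallel>\<^sup>2 = v \<parallel>x\<parallel>\<^sup>2\<close> with \<open>v = 4t + 1\<close>. As \<open>v\<close> is a sum of four rational squares, \<open>4t\<close> of the
  \<open>4t + 2\<close> terms of \<open>v \<parallel>x\<parallel>\<^sup>2\<close> become, after a linear substitution, plain squares \<open>z\<^sub>i\<^sup>2\<close>. As in the
  Bruck--Ryser argument these are cancelled one at a time by imposing \<open>(C x)\<^sub>i = \<plusminus>z\<^sub>i\<close>, the sign
  being chosen so that the equation can be solved for \<open>z\<^sub>i\<close>. What remains exhibits \<open>v\<close> as a sum
  of two rational squares, hence of two integer squares.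
\<close>

section \<open>Sums of squares\<close>

definition four_squares :: "rat \<Rightarrow> bool" where
  "four_squares x \<longleftrightarrow> (\<exists>a b c d. x = a\<^sup>2 + b\<^sup>2 + c\<^sup>2 + d\<^sup>2)"

text \<open>Euler's identity: the four squares are the components of the quaternion \<open>y\<close>
  times the conjugate of \<open>x\<close>.\<close>

lemma four_squares_mult:
  assumes "four_squares x" "four_squares y"
  shows "four_squares (x * y)"
proof -
  obtain a b c d where x: "x = a\<^sup>2 + b\<^sup>2 + c\<^sup>2 + d\<^sup>2"
    using assms(1) by (auto simp: four_squares_def)
  obtain p q r s where y: "y = p\<^sup>2 + q\<^sup>2 + r\<^sup>2 + s\<^sup>2"
    using assms(2) by (auto simp: four_squares_def)
  have "x * y = (a*p + b*q + c*r + d*s)\<^sup>2 + (a*q - b*p + c*s - d*r)\<^sup>2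
      + (a*r - c*p + d*q - b*s)\<^sup>2 + (a*s - d*p + b*r - c*q)\<^sup>2"
    unfolding x y by (simp add: power2_eq_square algebra_simps)
  then show ?thesis unfolding four_squares_def by blast
qed

lemma four_squares_square: "four_squares (a\<^sup>2)"
  unfolding four_squares_def by (intro exI[of _ a] exI[of _ 0]) simp

lemma four_squares_divide:
  assumes "four_squares x" "four_squares y"
  shows "four_squares (x / y)"
proof -
  have "x / y = x * y * (1 / y)\<^sup>2"
    by (simp add: power2_eq_square)
  then show ?thesis
    using assms four_squares_mult four_squares_square by metis
qed

text \<open>Pigeonhole: with \<open>p = 2 * h + 1\<close>, the \<open>h + 1\<close> residues
  \<open>x^2\<close> and the \<open>h + 1\<close> residues \<open>-1 - y^2\<close> cannot all be
  distinct modulo \<open>p\<close>.\<close>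

lemma prime_dvd_one_plus_two_squares:
  fixes p :: nat
  assumes "prime p" "odd p"
  obtains x y m :: nat where "1 + x\<^sup>2 + y\<^sup>2 = p * m" "m < p"
proof -
  obtain h where h: "p = 2 * h + 1" using assms(2) by (elim oddE)
  have "h > 0" using h prime_gt_1_nat[OF assms(1)] by auto
  define f where "f x = int x ^ 2 mod int p" for x
  define g where "g x = (- 1 - int x ^ 2) mod int p" for x
  have eq: "x = y" if "x \<le> h" "y \<le> h" "int p dvd int x ^ 2 - int y ^ 2" for x y
  proof -
    have "int p dvd (int x - int y) * (int x + int y)"
      using that(3) by (simp add: power2_eq_square algebra_simps)
    then have "int p dvd int x - int y \<or> int p dvd int x + int y"
      using assms(1) prime_dvd_multD[of "int p"] by simp
    then show ?thesis
    proof
      assume "int p dvd int x - int y"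
      moreover have "\<bar>int x - int y\<bar> < int p" using that h by auto
      ultimately show ?thesis using dvd_imp_le_int[of "int x - int y" "int p"] by force
    next
      assume "int p dvd int x + int y"
      moreover have "\<bar>int x + int y\<bar> < int p" using that h by auto
      ultimately show ?thesis using dvd_imp_le_int[of "int x + int y" "int p"] by force
    qed
  qed
  have injf: "inj_on f {..h}"
    by (rule inj_onI) (auto simp: f_def mod_eq_dvd_iff intro: eq)
  have injg: "inj_on g {..h}"
  proof (rule inj_onI)
    fix x y assume xy: "x \<in> {..h}" "y \<in> {..h}" "g x = g y"
    then have "int p dvd int y ^ 2 - int x ^ 2"
      by (simp add: g_def mod_eq_dvd_iff algebra_simps)
    then show "x = y" using xy eq[of y x] by simp
  qed
  have sub: "f ` {..h} \<union> g ` {..h} \<subseteq> {0..<int p}"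
    using h by (auto simp: f_def g_def)
  have "f ` {..h} \<inter> g ` {..h} \<noteq> {}"
  proof
    assume "f ` {..h} \<inter> g ` {..h} = {}"
    then have "card (f ` {..h} \<union> g ` {..h}) = (h + 1) + (h + 1)"
      by (simp add: card_Un_disjoint card_image injf injg)
    moreover have "card (f ` {..h} \<union> g ` {..h}) \<le> card {0..<int p}"
      using sub by (intro card_mono) auto
    ultimately show False using h by simp
  qed
  then obtain x y where xy: "x \<le> h" "y \<le> h" "f x = g y" by auto
  then have "int p dvd int (1 + x\<^sup>2 + y\<^sup>2)"
    by (simp add: f_def g_def mod_eq_dvd_iff algebra_simps)
  then have "p dvd 1 + x\<^sup>2 + y\<^sup>2" unfolding int_dvd_int_iff .
  then obtain m where m: "1 + x\<^sup>2 + y\<^sup>2 = p * m" by (elim dvdE)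
  \<comment> \<open>The representatives are at most \<open>h\<close>, about half of
    \<open>p\<close>, which keeps the sum below \<open>p * p\<close> and hence \<open>m\<close>
    below \<open>p\<close>.\<close>
  have "x\<^sup>2 \<le> h\<^sup>2" "y\<^sup>2 \<le> h\<^sup>2" using xy by (auto intro: power_mono)
  moreover have "p * p = 4 * h\<^sup>2 + 4 * h + 1"
    unfolding h by (simp add: power2_eq_square algebra_simps)
  ultimately have "p * m < p * p" using m \<open>h > 0\<close> by linarith
  then show ?thesis using m that by simp
qed

text \<open>Over the rationals Lagrange's theorem needs no descent: if \<open>p m = 1 + x\<^sup>2 + y\<^sup>2\<close> with
  \<open>m < p\<close>, then \<open>p\<close> is the quotient of two sums of four squares.\<close>

lemma four_squares_of_nat: "four_squares (of_nat n)"
proof (induction n rule: less_induct)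
  case (less n)
  consider "n \<le> 1" | "n = 2" | "prime n" "odd n" | "n > 1" "\<not> prime n"
    by (metis le_neq_implies_less not_le_imp_less prime_odd_nat prime_ge_2_nat)
  then show ?case
  proof cases
    case 1
    then have "of_nat n = ((of_nat n)\<^sup>2 :: rat)" by (cases n) auto
    then show ?thesis using four_squares_square by metis
  next
    case 2
    have "(of_nat n :: rat) = 1\<^sup>2 + 1\<^sup>2 + 0\<^sup>2 + 0\<^sup>2" using 2 by simp
    then show ?thesis unfolding four_squares_def by blast
  next
    case 3
    then obtain x y m where m: "1 + x\<^sup>2 + y\<^sup>2 = n * m" "m < n"
      by (rule prime_dvd_one_plus_two_squares)
    have "m > 0" using m(1) by (cases m) auto
    have "(of_nat (n * m) :: rat) = 1\<^sup>2 + (of_nat x)\<^sup>2 + (of_nat y)\<^sup>2 + 0\<^sup>2"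
      unfolding m(1)[symmetric] by simp
    then have "four_squares (of_nat (n * m))" unfolding four_squares_def by blast
    then have "four_squares (of_nat (n * m) / of_nat m)"
      using less.IH[OF m(2)] by (rule four_squares_divide)
    then show ?thesis using \<open>m > 0\<close> by simp
  next
    case 4
    then obtain a b where "n = a * b" "a < n" "b < n"
      using prime_nat_iff by (metis dvd_def dvd_imp_le le_neq_implies_less mult.right_neutral
          mult_cancel1 nat_neq_iff not_one_less_zero bot_nat_0.not_eq_extremum mult_is_0 mult.commute)
    then show ?thesis using less.IH four_squares_mult by simp
  qed
qed

section \<open>Cancelling squares in the Bruck-Ryser manner\<close>

lemma four_squares_similarity:
  assumes "four_squares v" "v \<noteq> 0"
  obtains M :: "nat \<Rightarrow> nat \<Rightarrow> rat"
  where "\<And>z. v * (\<Sum>j<4*t. (\<Sum>k<4*t. M j k * z k)\<^sup>2) = (\<Sum>k<4*t. (z k)\<^sup>2)"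
proof -
  obtain a b c d where v: "v = a\<^sup>2 + b\<^sup>2 + c\<^sup>2 + d\<^sup>2"
    using assms(1) by (auto simp: four_squares_def)
  have "\<exists>M :: nat \<Rightarrow> nat \<Rightarrow> rat.
      \<forall>z. v * (\<Sum>j<4*t. (\<Sum>k<4*t. M j k * z k)\<^sup>2) = (\<Sum>k<4*t. (z k)\<^sup>2)"
  proof (induction t)
    case 0
    then show ?case by simp
  next
    case (Suc t)
    then obtain M :: "nat \<Rightarrow> nat \<Rightarrow> rat" where
      M: "v * (\<Sum>j<4*t. (\<Sum>k<4*t. M j k * z k)\<^sup>2) = (\<Sum>k<4*t. (z k)\<^sup>2)" for z by blast
    \<comment> \<open>A quaternion multiplication matrix: its columns are orthogonal of squared norm
      \<open>v\<close>. Dividing by \<open>v\<close> gives a block with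
      \<open>v * |H z / v|^2 = |z|^2\<close>, and each induction step appends one such diagonal
      block.\<close>
    define H :: "rat list list" where
      "H = [[a, b, c, d], [-b, a, -d, c], [-c, d, a, -b], [-d, -c, b, a]]"
    define N where "N j k = (if j < 4*t \<and> k < 4*t then M j k
      else if j \<ge> 4*t \<and> k \<ge> 4*t then H ! (j - 4*t) ! (k - 4*t) / v else 0)" for j k
    have split: "(\<Sum>j<4 * Suc t. f j) =
        (\<Sum>j<4*t. f j) + f (4*t) + f (4*t+1) + f (4*t+2) + f (4*t+3)" for f :: "nat \<Rightarrow> rat"
      by (simp add: numeral_eq_Suc)
    have "v * (\<Sum>j<4*Suc t. (\<Sum>k<4*Suc t. N j k * z k)\<^sup>2) = (\<Sum>k<4*Suc t. (z k)\<^sup>2)" for z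
    proof -
      define p q r s where "p = z (4*t)" "q = z (4*t+1)" "r = z (4*t+2)" "s = z (4*t+3)"
      have low: "(\<Sum>k<4*Suc t. N j k * z k) = (\<Sum>k<4*t. M j k * z k)" if "j < 4*t" for j
        unfolding split using that by (simp add: N_def)
      have high: "(\<Sum>k<4*Suc t. N (4*t+i) k * z k) =
          (H!i!0 * p + H!i!1 * q + H!i!2 * r + H!i!3 * s) / v" for i
        unfolding split by (simp add: N_def p_q_r_s_def add_divide_distrib)
      define L where "L j = (\<Sum>k<4*Suc t. N j k * z k)" for j
      have scale: "v * ((A / v)\<^sup>2 + (B / v)\<^sup>2 + (C / v)\<^sup>2 + (D / v)\<^sup>2)
          = (A\<^sup>2 + B\<^sup>2 + C\<^sup>2 + D\<^sup>2) / v" for A B C D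
        using assms(2) by (simp add: field_simps power2_eq_square)
      have "v * ((L (4*t))\<^sup>2 + (L (4*t+1))\<^sup>2 + (L (4*t+2))\<^sup>2 + (L (4*t+3))\<^sup>2)
        = ((a*p + b*q + c*r + d*s)\<^sup>2 + (-b*p + a*q - d*r + c*s)\<^sup>2
          + (-c*p + d*q + a*r - b*s)\<^sup>2 + (-d*p - c*q + b*r + a*s)\<^sup>2) / v"
        unfolding scale[symmetric] L_def
        using high[of 0] high[of 1] high[of 2] high[of 3] by (simp add: H_def)
      also have "\<dots> = (v * (p\<^sup>2 + q\<^sup>2 + r\<^sup>2 + s\<^sup>2)) / v"
        unfolding v by (rule arg_cong2[where f = "(/)"]) (auto simp: algebra_simps power2_eq_square)
      finally have block: "v * ((L (4*t))\<^sup>2 + (L (4*t+1))\<^sup>2 + (L (4*t+2))\<^sup>2 + (L (4*t+3))\<^sup>2)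
          = p\<^sup>2 + q\<^sup>2 + r\<^sup>2 + s\<^sup>2" using assms(2) by simp
      have "v * (\<Sum>j<4*Suc t. (L j)\<^sup>2) = v * (\<Sum>j<4*t. (L j)\<^sup>2)
          + v * ((L (4*t))\<^sup>2 + (L (4*t+1))\<^sup>2 + (L (4*t+2))\<^sup>2 + (L (4*t+3))\<^sup>2)"
        unfolding split by (simp only: distrib_left add.assoc)
      also have "(\<Sum>j<4*t. (L j)\<^sup>2) = (\<Sum>j<4*t. (\<Sum>k<4*t. M j k * z k)\<^sup>2)"
        by (rule sum.cong) (simp_all only: L_def low lessThan_iff)
      also have "v * \<dots> + v * ((L (4*t))\<^sup>2 + (L (4*t+1))\<^sup>2 + (L (4*t+2))\<^sup>2 + (L (4*t+3))\<^sup>2)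
          = (\<Sum>k<4*Suc t. (z k)\<^sup>2)"
        unfolding M block split by (simp add: p_q_r_s_def)
      finally have "v * (\<Sum>j<4*Suc t. (L j)\<^sup>2) = (\<Sum>k<4*Suc t. (z k)\<^sup>2)" .
      then show ?thesis unfolding L_def .
    qed
    then show ?case by blast
  qed
  then show ?thesis using that by blast
qed

text \<open>Gaussian elimination of the last unknown: the free sign keeps each pivot nonzero,
  whatever \<open>A\<close> is, and disappears on squaring.\<close>

lemma sign_elimination:
  fixes A :: "nat \<Rightarrow> nat \<Rightarrow> rat"
  shows "\<exists>e :: nat \<Rightarrow> rat. (\<forall>i. (e i)\<^sup>2 = 1) \<and>
    (\<forall>b. \<exists>z. \<forall>i<j. e i * z i = (\<Sum>k<j. A i k * z k) + b i)"
proof (induction j arbitrary: A)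
  case 0
  show ?case by (rule exI[of _ "\<lambda>_. 1"]) simp
next
  case (Suc j)
  define s :: rat where "s = (if A j j = 1 then -1 else 1)"
  have s: "s\<^sup>2 = 1" "s - A j j \<noteq> 0" by (auto simp: s_def)
  define d where "d = s - A j j"
  \<comment> \<open>The coefficients are those left after the last equation, with pivot
    \<open>d\<close>, has been solved for its unknown and substituted into the others.\<close>
  obtain e :: "nat \<Rightarrow> rat" where e: "\<And>i. (e i)\<^sup>2 = 1"
    and solve: "\<And>b. \<exists>z. \<forall>i<j. e i * z i = (\<Sum>k<j. (A i k + A i j * A j k / d) * z k) + b i"
    using Suc.IH[of "\<lambda>i k. A i k + A i j * A j k / d"] by blast
  have "\<exists>z. \<forall>i<Suc j. (e(j := s)) i * z i = (\<Sum>k<Suc j. A i k * z k) + b i" for b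
  proof -
    obtain z where z: "\<And>i. i < j \<Longrightarrow> e i * z i =
        (\<Sum>k<j. (A i k + A i j * A j k / d) * z k) + (b i + A i j * b j / d)"
      using solve[of "\<lambda>i. b i + A i j * b j / d"] by blast
    define w where "w = ((\<Sum>k<j. A j k * z k) + b j) / d"
    have "(e(j := s)) i * (z(j := w)) i = (\<Sum>k<Suc j. A i k * (z(j := w)) k) + b i"
      if "i < Suc j" for i
    proof (cases "i = j")
      case True
      have "d * w = (\<Sum>k<j. A j k * z k) + b j" using s by (simp add: w_def d_def)
      then show ?thesis using True by (simp add: d_def algebra_simps)
    next
      case False
      then have "i < j" using that by simp
      have "A i j * w = (\<Sum>k<j. A i j * A j k / d * z k) + A i j * b j / d"
        by (simp add: w_def add_divide_distrib sum_distrib_left sum_divide_distrib algebra_simps)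
      then show ?thesis using z[OF \<open>i < j\<close>] \<open>i < j\<close>
        by (simp add: ring_distribs sum.distrib)
    qed
    then show ?thesis by blast
  qed
  moreover have "((e(j := s)) i)\<^sup>2 = 1" for i using e s by simp
  ultimately show ?case by blast
qed

lemma similarity_imp_two_rational_squares:
  fixes C :: "nat \<Rightarrow> nat \<Rightarrow> rat"
  assumes sim: "\<And>x. (\<Sum>i<4*t+2. (\<Sum>j<4*t+2. C i j * x j)\<^sup>2) = v * (\<Sum>j<4*t+2. (x j)\<^sup>2)"
    and v: "four_squares v" "v \<noteq> 0"
  obtains a b where "v = a\<^sup>2 + b\<^sup>2"
proof -
  obtain M :: "nat \<Rightarrow> nat \<Rightarrow> rat"
    where M: "\<And>z. v * (\<Sum>j<4*t. (\<Sum>k<4*t. M j k * z k)\<^sup>2) = (\<Sum>k<4*t. (z k)\<^sup>2)"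
    using four_squares_similarity[OF v] by blast
  define A where "A i k = (\<Sum>j<4*t. C i j * M j k)" for i k
  obtain e :: "nat \<Rightarrow> rat" where e: "\<And>i. (e i)\<^sup>2 = 1"
    and solve: "\<And>b. \<exists>z. \<forall>i<4*t. e i * z i = (\<Sum>k<4*t. A i k * z k) + b i"
    using sign_elimination[of "4*t" A] by blast
  obtain z where z: "\<And>i. i < 4*t \<Longrightarrow> e i * z i = (\<Sum>k<4*t. A i k * z k) + C i (4*t)"
    using solve[of "\<lambda>i. C i (4*t)"] by blast
  \<comment> \<open>The first \<open>4*t\<close> coordinates are \<open>M z\<close>. The entry 1
    contributes the inhomogeneous term \<open>C i (4*t)\<close> and keeps a single \<open>v\<close>
    on the right once the squares cancel.\<close>
  define x where "x j = (if j < 4*t then \<Sum>k<4*t. M j k * z k else if j = 4*t then 1 else 0)" for j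
  define y where "y i = (\<Sum>j<4*t+2. C i j * x j)" for i
  have split: "(\<Sum>j<4*t+2. f j) = (\<Sum>j<4*t. f j) + f (4*t) + f (4*t+1)" for f :: "nat \<Rightarrow> rat"
    by (simp add: numeral_eq_Suc)
  have "y i = e i * z i" if "i < 4*t" for i
  proof -
    have "(\<Sum>j<4*t. C i j * x j) = (\<Sum>j<4*t. \<Sum>k<4*t. C i j * M j k * z k)"
      by (simp add: x_def sum_distrib_left mult.assoc)
    also have "\<dots> = (\<Sum>k<4*t. A i k * z k)"
      unfolding A_def by (subst sum.swap) (simp add: sum_distrib_right)
    finally show ?thesis using z[OF that] unfolding y_def split by (simp add: x_def)
  qed
  then have "(\<Sum>i<4*t. (y i)\<^sup>2) = (\<Sum>i<4*t. (z i)\<^sup>2)"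
    by (simp add: power_mult_distrib e)
  also have "\<dots> = v * (\<Sum>j<4*t. (x j)\<^sup>2)"
    using M[of z] by (simp add: x_def)
  finally have "v = (y (4*t))\<^sup>2 + (y (4*t+1))\<^sup>2"
    using sim[of x] unfolding y_def[symmetric] split by (simp add: x_def algebra_simps)
  then show ?thesis by (rule that)
qed

text \<open>The hypothesis says that the transpose of \<open>C\<close> times \<open>C\<close> is
  \<open>v\<close> times the identity; the squared norm of \<open>C x\<close> is the associated
  quadratic form.\<close>

lemma orthogonal_columns_norm:
  fixes C :: "nat \<Rightarrow> nat \<Rightarrow> rat"
  assumes orth: "\<And>j j'. j < N \<Longrightarrow> j' < N \<Longrightarrow>
    (\<Sum>i<N. C i j * C i j') = (if j = j' then v else 0)"
  shows "(\<Sum>i<N. (\<Sum>j<N. C i j * x j)\<^sup>2) = v * (\<Sum>j<N. (x j)\<^sup>2)"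
proof -
  have "(\<Sum>i<N. (\<Sum>j<N. C i j * x j)\<^sup>2)
      = (\<Sum>i<N. \<Sum>j<N. \<Sum>j'<N. x j * x j' * (C i j * C i j'))"
    by (simp add: power2_eq_square sum_product mult_ac)
  also have "\<dots> = (\<Sum>j<N. \<Sum>i<N. \<Sum>j'<N. x j * x j' * (C i j * C i j'))"
    by (rule sum.swap)
  also have "\<dots> = (\<Sum>j<N. \<Sum>j'<N. \<Sum>i<N. x j * x j' * (C i j * C i j'))"
    by (intro sum.cong refl sum.swap)
  also have "\<dots> = (\<Sum>j<N. \<Sum>j'<N. x j * x j' * (if j = j' then v else 0))"
    unfolding sum_distrib_left[symmetric] by (intro sum.cong refl) (simp add: orth)
  also have "\<dots> = (\<Sum>j<N. v * (x j)\<^sup>2)"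
    by (intro sum.cong refl)
      (simp add: if_distrib[of "\<lambda>y. _ * y"] power2_eq_square mult_ac cong: if_cong)
  finally show ?thesis by (simp add: sum_distrib_left)
qed

section \<open>From two rational squares to two integer squares\<close>

lemma nearest_multiple:
  fixes a c :: int
  assumes "c > 0"
  obtains p r where "a = c * p + r" "2 * \<bar>r\<bar> \<le> c"
proof -
  \<comment> \<open>Rounding to the nearest integer: the floor of \<open>a/c + 1/2\<close>.\<close>
  define p where "p = (2 * a + c) div (2 * c)"
  define r where "r = (2 * a + c) mod (2 * c)"
  have "2 * a + c = 2 * (c * p) + r"
    using mult_div_mod_eq[of "2 * c" "2 * a + c"] by (simp add: p_def r_def mult.assoc)
  moreover have "0 \<le> r" "r < 2 * c" using assms by (auto simp: r_def)
  ultimately have "2 * \<bar>a - c * p\<bar> \<le> c" by (simp add: abs_if)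
  then show ?thesis using that[of p "a - c * p"] by simp
qed

text \<open>Davenport--Cassels descent: the line through the rational point \<open>(a/c, b/c)\<close> of the circle
  and a nearest integer point meets the circle again in a point of smaller denominator \<open>w\<close>.\<close>

lemma two_squares_descent:
  fixes v a b :: int
  assumes "c > 0" "v * (int c)\<^sup>2 = a\<^sup>2 + b\<^sup>2"
  shows "\<exists>p q. v = p\<^sup>2 + q\<^sup>2"
  using assms
proof (induction c arbitrary: a b rule: less_induct)
  case (less c)
  obtain p r where p: "a = int c * p + r" "2 * \<bar>r\<bar> \<le> int c"
    using nearest_multiple less.prems(1) by (metis of_nat_0_less_iff)
  obtain q s where q: "b = int c * q + s" "2 * \<bar>s\<bar> \<le> int c"
    using nearest_multiple less.prems(1) by (metis of_nat_0_less_iff)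
  \<comment> \<open>This is \<open>c\<close> times the squared distance from
    \<open>(a/c, b/c)\<close> to \<open>(p, q)\<close>, written so that it is visibly an
    integer.\<close>
  define w where "w = v * int c - 2 * (p * a + q * b) + int c * (p\<^sup>2 + q\<^sup>2)"
  have circle: "v * int c * int c = (int c * p + r)\<^sup>2 + (int c * q + s)\<^sup>2"
    using less.prems(2) p(1) q(1) by (simp add: power2_eq_square mult.assoc)
  have rs: "r\<^sup>2 + s\<^sup>2 = int c * w"
    unfolding w_def p(1) q(1) using circle by (simp add: power2_eq_square algebra_simps)
  have "(2 * \<bar>r\<bar>)\<^sup>2 \<le> (int c)\<^sup>2" "(2 * \<bar>s\<bar>)\<^sup>2 \<le> (int c)\<^sup>2"
    using p(2) q(2) by (intro power_mono; simp)+
  then have "2 * (int c * w) \<le> int c * int c"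
    using rs by (simp add: power2_eq_square)
  then have "2 * w \<le> int c" using less.prems(1) by simp
  have "int c * w \<ge> 0" using rs by (metis sum_power2_ge_zero)
  then have "w \<ge> 0" using less.prems(1) by (simp add: zero_le_mult_iff)
  show ?case
  proof (cases "w = 0")
    case True
    then have "r = 0" "s = 0" using rs by auto
    then have "int c * int c * v = int c * int c * (p\<^sup>2 + q\<^sup>2)"
      using circle by (simp add: power2_eq_square algebra_simps)
    then have "v = p\<^sup>2 + q\<^sup>2" using less.prems(1) by simp
    then show ?thesis by blast
  next
    case False
    \<comment> \<open>Points \<open>(p + x r, q + x s)\<close> on the circle satisfy
      \<open>u + 2 (p r + q s) x + c w x^2 = 0\<close>. One root is \<open>1/c\<close>, which is the
      fact \<open>wu\<close>; hence the other is \<open>u/w\<close>.\<close>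
    define u where "u = p\<^sup>2 + q\<^sup>2 - v"
    have wu: "w + int c * u + 2 * (p * r + q * s) = 0"
      unfolding w_def u_def p(1) q(1) by (simp add: power2_eq_square algebra_simps)
    have "(w * p + u * r)\<^sup>2 + (w * q + u * s)\<^sup>2
        = w\<^sup>2 * (p\<^sup>2 + q\<^sup>2) + u * w * (2 * (p * r + q * s)) + u\<^sup>2 * (r\<^sup>2 + s\<^sup>2)"
      by (simp add: power2_eq_square algebra_simps)
    also have "\<dots> = w\<^sup>2 * (p\<^sup>2 + q\<^sup>2) + u * w * (w + int c * u + 2 * (p * r + q * s)) - u * w\<^sup>2"
      unfolding rs by (simp add: power2_eq_square algebra_simps)
    also have "\<dots> = v * w\<^sup>2" unfolding wu by (simp add: u_def algebra_simps)
    finally have "v * (int (nat w))\<^sup>2 = (w * p + u * r)\<^sup>2 + (w * q + u * s)\<^sup>2"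
      using \<open>w \<ge> 0\<close> by simp
    moreover have "nat w < c" "nat w > 0"
      using False \<open>w \<ge> 0\<close> \<open>2 * w \<le> int c\<close> by auto
    ultimately show ?thesis using less.IH by blast
  qed
qed

lemma two_rational_squares_imp_two_squares:
  fixes v :: int and a b :: rat
  assumes "of_int v = a\<^sup>2 + b\<^sup>2"
  shows "\<exists>p q. v = p\<^sup>2 + q\<^sup>2"
proof -
  obtain a1 a2 where a: "a = of_int a1 / of_int a2" "a2 > 0"
    by (cases a) (auto simp: Fract_of_int_quotient)
  obtain b1 b2 where b: "b = of_int b1 / of_int b2" "b2 > 0"
    by (cases b) (auto simp: Fract_of_int_quotient)
  have "(of_int (v * (a2 * b2)\<^sup>2) :: rat) = of_int ((a1 * b2)\<^sup>2 + (b1 * a2)\<^sup>2)"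
    using assms a b by (simp add: field_simps)
  then have "v * (a2 * b2)\<^sup>2 = (a1 * b2)\<^sup>2 + (b1 * a2)\<^sup>2" by (simp only: of_int_eq_iff)
  moreover have "a2 * b2 = int (nat (a2 * b2))" "nat (a2 * b2) > 0"
    using a(2) b(2) by (auto simp: zero_le_mult_iff)
  ultimately show ?thesis using two_squares_descent by metis
qed

section \<open>Distance-two graphs and complements\<close>

text \<open>With unit weights a walk costs its length. A finite distance is attained by a path;
  conversely, distinctness and non-adjacency exclude walks of length 0 and 1.\<close>

lemma graph_dist_eq_2_iff:
  assumes "pair_graph G" "u \<in> pverts G" "v \<in> pverts G"
  shows "graph_dist G u v = 2 \<longleftrightarrow>
    u \<noteq> v \<and> (u, v) \<notin> parcs G \<and> (\<exists>w. (u, w) \<in> parcs G \<and> (w, v) \<in> parcs G)"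
proof -
  interpret pair_graph G by fact
  have cost: "awalk_cost (\<lambda>_. 1) p = real (length p)" for p :: "('a \<times> 'a) list"
    by (induction p) auto
  note awalk_simps = awalk_Cons_iff awalk_Nil_iff
  show ?thesis
  proof
    assume "graph_dist G u v = 2"
    then have mu: "\<mu> (\<lambda>_. 1) u v = 2" by (simp add: graph_dist_def)
    then have "\<mu> (\<lambda>_. 1) u v < \<infinity>" by simp
    then obtain p where p: "apath u p v" "\<mu> (\<lambda>_. 1) u v = awalk_cost (\<lambda>_. 1) p"
      using min_cost_awalk[of u v "\<lambda>_. 1"] unfolding \<mu>_reach_conv by auto
    have "length p = 2" using p(2) mu cost by simp
    have le: "2 \<le> length q" if "awalk u q v" for q
      using min_cost_le_walk_cost[OF that, of "\<lambda>_. 1"] mu cost by simp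
    have "u \<noteq> v" using le[of "[]"] assms by (auto simp: awalk_simps)
    moreover have "(u, v) \<notin> parcs G" using le[of "[(u, v)]"] assms by (auto simp: awalk_simps)
    moreover have "\<exists>w. (u, w) \<in> parcs G \<and> (w, v) \<in> parcs G"
      using p(1) \<open>length p = 2\<close>
      by (auto simp: apath_def numeral_2_eq_2 length_Suc_conv awalk_simps)
    ultimately show "u \<noteq> v \<and> (u, v) \<notin> parcs G \<and> (\<exists>w. (u, w) \<in> parcs G \<and> (w, v) \<in> parcs G)"
      by blast
  next
    assume R: "u \<noteq> v \<and> (u, v) \<notin> parcs G \<and> (\<exists>w. (u, w) \<in> parcs G \<and> (w, v) \<in> parcs G)"
    then obtain w where w: "(u, w) \<in> parcs G" "(w, v) \<in> parcs G" by blast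
    then have "awalk u [(u, w), (w, v)] v" using assms by (auto simp: awalk_simps)
    then have "\<mu> (\<lambda>_. 1) u v \<le> 2" 
      using min_cost_le_walk_cost[of u "[(u, w), (w, v)]" v "\<lambda>_. 1"] by (simp add: cost)
    moreover have "2 \<le> \<mu> (\<lambda>_. 1) u v" unfolding \<mu>_def
    proof (rule INF_greatest)
      fix p assume "p \<in> {p. awalk u p v}"
      then have "awalk u p v" by simp
      have "2 \<le> length p"
      proof (rule ccontr)
        assume "\<not> 2 \<le> length p"
        then consider "p = []" | e where "p = [e]" by (cases p; cases "tl p") auto
        then show False using \<open>awalk u p v\<close> R by cases (auto simp: awalk_simps)
      qed
      then show "2 \<le> ereal (awalk_cost (\<lambda>_. 1) p)" by (simp add: cost)
    qed
    ultimately show "graph_dist G u v = 2" by (simp add: graph_dist_def)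
  qed
qed

lemma graph_isoE:
  assumes "graph_iso G H" "pair_wf_digraph G"
  obtains f where "bij_betw f (pverts G) (pverts H)"
    "\<And>u w. u \<in> pverts G \<Longrightarrow> w \<in> pverts G \<Longrightarrow> (f u, f w) \<in> parcs H \<longleftrightarrow> (u, w) \<in> parcs G"
proof -
  interpret pair_wf_digraph G by fact
  obtain h where h: "digraph_isomorphism h" "with_proj H = app_iso h (with_proj G)"
    using assms(1) by (auto simp: graph_iso_def digraph_iso_def)
  have inj: "inj_on (iso_verts h) (pverts G)"
    using digraph_isomorphism_inj_on_verts[OF h(1)] by simp
  have V: "pverts H = iso_verts h ` pverts G"
    using arg_cong[OF h(2), of verts] by simp
  \<comment> \<open>Passing to end pairs expresses the arcs of \<open>H\<close> through the vertex
    map alone.\<close>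
  have A: "parcs H = (\<lambda>(u, v). (iso_verts h u, iso_verts h v)) ` parcs G"
    using arg_cong[OF h(2), of arcs_ends] arcs_ends_app_iso_eq[OF h(1)] by simp
  show ?thesis
  proof (rule that)
    show "bij_betw (iso_verts h) (pverts G) (pverts H)" using inj V by (simp add: bij_betw_def)
    show "(iso_verts h u, iso_verts h w) \<in> parcs H \<longleftrightarrow> (u, w) \<in> parcs G"
      if "u \<in> pverts G" "w \<in> pverts G" for u w
      using that inj unfolding A by (auto dest: in_arcsD1 in_arcsD2 inj_onD)
  qed
qed

lemma graph_iso_sym:
  assumes "graph_iso G H" "pair_wf_digraph G"
  shows "graph_iso H G"
proof -
  interpret pair_wf_digraph G by fact
  show ?thesis using assms(1) digraph_iso_swap wf_digraph_axioms unfolding graph_iso_def by blast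
qed


lemma pair_graph_complement:
  assumes "finite (pverts G)" "sym (parcs G)"
  shows "pair_graph (graph_complement G)"
proof unfold_locales
  show "finite (parcs (graph_complement G))"
    by (rule finite_subset[of _ "pverts G \<times> pverts G"]) (auto simp: graph_complement_def assms)
  show "symmetric (with_proj (graph_complement G))"
    using assms(2) by (auto simp: graph_complement_def symmetric_def sym_def)
qed (auto simp: graph_complement_def assms)

lemma neighbours_graph_complement:
  assumes "u \<in> pverts G"
  shows "neighbours (graph_complement G) u = pverts G - insert u (neighbours G u)"
  using assms by (auto simp: neighbours_def graph_complement_def)

lemma neighbours_image_iso:
  assumes "pair_wf_digraph G" "pair_wf_digraph H" "bij_betw f (pverts G) (pverts H)"
    and "\<And>u w. u \<in> pverts G \<Longrightarrow> w \<in> pverts G \<Longrightarrow> (f u, f w) \<in> parcs H \<longleftrightarrow> (u, w) \<in> parcs G"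
    and "u \<in> pverts G"
  shows "neighbours H (f u) = f ` neighbours G u"
proof -
  interpret G: pair_wf_digraph G by fact
  interpret H: pair_wf_digraph H by fact
  have "f ` pverts G = pverts H" using assms(3) by (simp add: bij_betw_def)
  show ?thesis
  proof (intro set_eqI iffI)
    fix y assume y: "y \<in> neighbours H (f u)"
    then have "y \<in> f ` pverts G"
      using H.in_arcsD2 \<open>f ` pverts G = pverts H\<close> by (auto simp: neighbours_def)
    then show "y \<in> f ` neighbours G u" using y assms(4,5) by (auto simp: neighbours_def)
  next
    fix y assume "y \<in> f ` neighbours G u"
    then show "y \<in> neighbours H (f u)"
      using assms(4,5) G.in_arcsD2 by (auto simp: neighbours_def)
  qed
qed

section \<open>Strongly regular graphs\<close>

locale strongly_regular_graph = pair_graph G for G :: "'a pair_pre_digraph" +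
  fixes n k l m :: nat
  assumes strongly_regular: "strongly_regular G n k l m"
begin

abbreviation V :: "'a set" where "V \<equiv> pverts G"
abbreviation N :: "'a \<Rightarrow> 'a set" where "N \<equiv> neighbours G"

lemma card_verts: "card V = n"
  and degree: "u \<in> V \<Longrightarrow> card (N u) = k"
  and common_nonadjacent:
    "\<lbrakk>u \<in> V; w \<in> V; u \<noteq> w; (u, w) \<notin> parcs G\<rbrakk> \<Longrightarrow> card (N u \<inter> N w) = m"
  and arcs_nonempty: "parcs G \<noteq> {}"
  using strongly_regular by (simp_all add: strongly_regular_def)

lemma common_adjacent: "(u, w) \<in> parcs G \<Longrightarrow> card (N u \<inter> N w) = l"
  using strongly_regular in_arcsD1[of u w] in_arcsD2[of u w] by (simp add: strongly_regular_def)

lemma mem_neighbours_iff: "w \<in> N u \<longleftrightarrow> (u, w) \<in> parcs G"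
  by (simp add: neighbours_def)

lemma arcs_sym: "(u, w) \<in> parcs G \<longleftrightarrow> (w, u) \<in> parcs G"
  using pair_sym_arcs by (auto simp: symmetric_def sym_def)

lemma neighbours_subset: "N u \<subseteq> V"
  using in_arcsD2 by (auto simp: neighbours_def)

lemma finite_neighbours: "finite (N u)"
  using neighbours_subset pair_finite_verts by (rule finite_subset)

lemma not_self_neighbour: "u \<notin> N u"
  using pair_no_loops[of "(u, u)"] by (auto simp: neighbours_def)

text \<open>Non-completeness enters here: the arcs form a proper subset of all pairs of distinct
  vertices.\<close>

lemma nonadjacent_exist:
  obtains u w where "u \<in> V" "w \<in> V" "u \<noteq> w" "(u, w) \<notin> parcs G"
proof -
  have "parcs G \<noteq> {(u, v). (u, v) \<in> V \<times> V \<and> u \<noteq> v}"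
    using strongly_regular pair_finite_verts
    by (auto simp: strongly_regular_def complete_digraph_pair_def)
  moreover have "parcs G \<subseteq> {(u, v). (u, v) \<in> V \<times> V \<and> u \<noteq> v}"
    using in_arcsD1 in_arcsD2 pair_no_loops by fastforce
  ultimately show ?thesis using that by blast
qed

lemma card_non_neighbours: "u \<in> V \<Longrightarrow> card (V - insert u (N u)) = n - Suc k"
  using finite_neighbours neighbours_subset not_self_neighbour degree card_verts
  by (subst card_Diff_subset) auto

text \<open>Walks of length two from \<open>u\<close> are counted by midpoint and by endpoint, the
  endpoint being \<open>u\<close>, a neighbour or a non-neighbour.\<close>

lemma double_count:
  assumes u: "u \<in> V"
  shows "k * k = k + k * l + (n - Suc k) * m"
proof -
  have card_int: "card (N u \<inter> N w) = (\<Sum>x\<in>N u. if w \<in> N x then 1 else 0)" for w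
    using finite_neighbours[of u]
    by (simp add: mem_neighbours_iff[of w] arcs_sym[of _ w] sum.If_cases neighbours_def)
  have "(\<Sum>w\<in>V. card (N u \<inter> N w)) = (\<Sum>x\<in>N u. \<Sum>w\<in>V. if w \<in> N x then 1 else 0)"
    unfolding card_int by (rule sum.swap)
  also have "\<dots> = (\<Sum>x\<in>N u. card (N x))"
    using pair_finite_verts neighbours_subset
    by (intro sum.cong refl) (simp add: sum.If_cases Int_absorb1)
  also have "\<dots> = (\<Sum>x\<in>N u. k)"
    using neighbours_subset[of u] degree by (intro sum.cong) auto
  finally have total: "(\<Sum>w\<in>V. card (N u \<inter> N w)) = k * k" using degree u by simp
  have "V = insert u (N u \<union> (V - insert u (N u)))" using neighbours_subset u by auto
  then have "(\<Sum>w\<in>V. card (N u \<inter> N w))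
      = (\<Sum>w\<in>insert u (N u \<union> (V - insert u (N u))). card (N u \<inter> N w))" by simp
  also have "\<dots> = card (N u \<inter> N u) + ((\<Sum>w\<in>N u. card (N u \<inter> N w))
      + (\<Sum>w\<in>V - insert u (N u). card (N u \<inter> N w)))"
    using pair_finite_verts finite_neighbours not_self_neighbour
    by (subst sum.insert, simp, simp, subst sum.union_disjoint) auto
  also have "(\<Sum>w\<in>N u. card (N u \<inter> N w)) = (\<Sum>w\<in>N u. l)"
    by (intro sum.cong refl common_adjacent) (simp add: mem_neighbours_iff)
  also have "(\<Sum>w\<in>V - insert u (N u). card (N u \<inter> N w)) = (\<Sum>w\<in>V - insert u (N u). m)"
    using u by (intro sum.cong refl common_nonadjacent) (auto simp: mem_neighbours_iff)
  finally show ?thesis using total u by (simp add: degree card_non_neighbours)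
qed

text \<open>Vertices at distance two share a neighbour, so \<open>m = 0\<close> would leave
  \<open>dist2_graph G\<close> without arcs.\<close>

lemma dist2_graph_iso_imp_m_pos:
  assumes iso: "graph_iso (dist2_graph G) G"
  shows "m > 0"
proof (rule ccontr)
  assume "\<not> m > 0"
  have "graph_dist G u w \<noteq> 2" if uw: "u \<in> V" "w \<in> V" for u w
  proof
    assume "graph_dist G u w = 2"
    then obtain x where x: "u \<noteq> w" "(u, w) \<notin> parcs G" "(u, x) \<in> parcs G" "(x, w) \<in> parcs G"
      using graph_dist_eq_2_iff[OF pair_graph_axioms uw] by blast
    then have "x \<in> N u \<inter> N w" using arcs_sym[of x w] by (simp add: mem_neighbours_iff)
    then have "card (N u \<inter> N w) > 0" using finite_neighbours by (auto simp: card_gt_0_iff)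
    then show False using common_nonadjacent[OF uw x(1,2)] \<open>\<not> m > 0\<close> by simp
  qed
  then have "parcs (dist2_graph G) = {}" by (auto simp: dist2_graph_def)
  moreover obtain h where "with_proj G = app_iso h (with_proj (dist2_graph G))"
    using iso by (auto simp: graph_iso_def digraph_iso_def)
  then have "parcs G = iso_arcs h ` parcs (dist2_graph G)"
    by (metis arcs_app_iso with_proj_simps(2))
  ultimately show False using arcs_nonempty by simp
qed

lemma dist2_graph_eq_complement:
  assumes "m > 0"
  shows "dist2_graph G = graph_complement G"
proof -
  have "\<exists>x. (u, x) \<in> parcs G \<and> (x, w) \<in> parcs G"
    if "u \<in> V" "w \<in> V" "u \<noteq> w" "(u, w) \<notin> parcs G" for u w
  proof -
    have "N u \<inter> N w \<noteq> {}" using common_nonadjacent[OF that] assms by auto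
    then show ?thesis using arcs_sym by (auto simp: mem_neighbours_iff)
  qed
  then show ?thesis
    using graph_dist_eq_2_iff[OF pair_graph_axioms]
    by (auto simp: dist2_graph_def graph_complement_def)
qed

text \<open>Degrees in \<open>G\<close> and its complement give \<open>n = 2 * k + 1\<close>, common
  neighbours give \<open>l = m - 1\<close>, and double counting then yields
  \<open>k = 1 + l + m\<close>.\<close>

lemma conference_parameters:
  assumes "m > 0" and iso: "graph_iso (graph_complement G) G"
  shows "n = 4 * m + 1" "k = 2 * m" "l = m - 1"
proof -
  have "pair_graph (graph_complement G)"
    using pair_finite_verts pair_sym_arcs
    by (intro pair_graph_complement) (simp_all add: symmetric_def)
  then interpret C: pair_graph "graph_complement G" .
  have VC: "pverts (graph_complement G) = V" by (simp add: graph_complement_def)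
  obtain f where f: "bij_betw f V V" and
    arcs: "\<And>u w. u \<in> V \<Longrightarrow> w \<in> V \<Longrightarrow>
      (f u, f w) \<in> parcs G \<longleftrightarrow> (u, w) \<in> parcs (graph_complement G)"
    using graph_isoE[OF iso C.pair_wf_digraph_axioms] unfolding VC by metis
  have inj: "inj_on f V" and im: "\<And>u. u \<in> V \<Longrightarrow> f u \<in> V"
    using f by (auto simp: bij_betw_def)
  have Nf: "N (f u) = f ` (V - insert u (N u))" if "u \<in> V" for u
    using neighbours_image_iso[OF C.pair_wf_digraph_axioms pair_wf_digraph_axioms]
      f arcs that neighbours_graph_complement[of u G] unfolding VC by metis
  obtain u w where uw: "u \<in> V" "w \<in> V" "u \<noteq> w" "(u, w) \<notin> parcs G"
    by (rule nonadjacent_exist)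
  then have notN: "w \<notin> N u" "u \<notin> N w" using arcs_sym by (auto simp: mem_neighbours_iff)
  have "k = card (N (f u))" using degree im uw(1) by simp
  also have "\<dots> = card (V - insert u (N u))"
    using Nf[OF uw(1)] inj by (simp add: card_image inj_on_diff)
  finally have k: "k = n - Suc k" using card_non_neighbours uw(1) by simp
  have "card (insert u (N u)) \<le> card V"
    using pair_finite_verts neighbours_subset uw(1) by (intro card_mono) auto
  then have "Suc k \<le> n"
    using card_verts degree uw(1) finite_neighbours not_self_neighbour by simp
  then have n: "n = 2 * k + 1" using k by simp

  \<comment> \<open>A non-adjacent pair of \<open>G\<close> is adjacent in the complement, so its
    image is a pair to which \<open>l\<close> applies.\<close>
  have "(f u, f w) \<in> parcs G"
    using arcs[OF uw(1,2)] uw by (simp add: graph_complement_def)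
  then have "l = card (N (f u) \<inter> N (f w))" by (simp add: common_adjacent)
  also have "\<dots> = card (f ` ((V - insert u (N u)) \<inter> (V - insert w (N w))))"
    unfolding Nf[OF uw(1)] Nf[OF uw(2)] using inj by (subst inj_on_image_Int[of f V]) auto
  also have "\<dots> = card (V - insert u (insert w (N u \<union> N w)))"
    using inj by (subst card_image) (auto intro: inj_on_subset intro!: arg_cong[of _ _ card])
  also have "\<dots> = n - Suc (Suc (card (N u \<union> N w)))"
    using finite_neighbours neighbours_subset not_self_neighbour uw card_verts notN
    by (subst card_Diff_subset) auto
  finally have l: "l = n - Suc (Suc (card (N u \<union> N w)))" .
  have "card (N u) + card (N w) = card (N u \<union> N w) + card (N u \<inter> N w)"
    by (rule card_Un_Int) (simp_all add: finite_neighbours)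
  then have un: "card (N u \<union> N w) + m = 2 * k"
    using common_nonadjacent[OF uw] degree uw(1,2) by simp
  have lm: "l + 1 = m" using l un n \<open>m > 0\<close> by linarith
  \<comment> \<open>Since \<open>n - Suc k = k\<close>, every term of the double count has the
    factor \<open>k\<close>.\<close>
  have "k * k = k * (1 + l + m)"
    using double_count[OF uw(1)] n by (simp add: algebra_simps)
  moreover have "k > 0" using un \<open>m > 0\<close> by linarith
  ultimately have "k = 1 + l + m" by (simp only: nat_mult_eq_cancel1)
  then show "n = 4 * m + 1" "k = 2 * m" "l = m - 1" using lm n by simp_all
qed

section \<open>The Seidel matrix and the order of the graph\<close>

definition seidel :: "'a \<Rightarrow> 'a \<Rightarrow> rat" where
  "seidel u w = 1 - of_bool (u = w) - 2 * of_bool (u \<in> N w)"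

lemma sum_of_bool_neighbours:
  assumes "w \<in> V"
  shows "(\<Sum>u\<in>V. of_bool (u \<in> N w) :: rat) = of_nat k"
proof -
  have "V \<inter> {u. u \<in> N w} = N w" using neighbours_subset by auto
  then show ?thesis using degree[OF assms] pair_finite_verts by (simp add: sum_of_bool_eq)
qed

lemma sum_of_bool_eq_mult:
  assumes "w \<in> V"
  shows "(\<Sum>u\<in>V. of_bool (u = w) * f u :: rat) = f w"
  using assms pair_finite_verts
  by (simp add: of_bool_def if_distrib[of "\<lambda>x. x * _"] sum.delta cong: if_cong)

lemma seidel_column_sum:
  assumes "w \<in> V"
  shows "(\<Sum>u\<in>V. seidel u w) = of_nat n - 1 - 2 * of_nat k"
proof -
  \<comment> \<open>The factor 1 gives the diagonal term the shape that
    \<open>sum_of_bool_eq_mult\<close> rewrites.\<close>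
  have "seidel u w = 1 - of_bool (u = w) * 1 - 2 * of_bool (u \<in> N w)" for u
    by (simp add: seidel_def)
  then show ?thesis
    by (simp only: sum_subtractf sum_distrib_left[symmetric] sum_of_bool_eq_mult
        sum_of_bool_neighbours assms) (simp add: card_verts)
qed

text \<open>Entrywise expansion of \<open>(J - I - 2A)^2\<close>, with \<open>J\<close> the all-ones
  and \<open>A\<close> the adjacency matrix; \<open>A^2\<close> counts the common
  neighbours.\<close>

lemma seidel_columns_inner:
  assumes w: "w \<in> V" "w' \<in> V"
  shows "(\<Sum>u\<in>V. seidel u w * seidel u w') = of_nat n - 2 - 4 * of_nat k + of_bool (w = w')
    + 4 * of_bool ((w, w') \<in> parcs G) + 4 * of_nat (card (N w \<inter> N w'))"
proof -
  have int: "(\<Sum>u\<in>V. of_bool (u \<in> N w) * of_bool (u \<in> N w') :: rat) = of_nat (card (N w \<inter> N w'))"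
  proof -
    have "V \<inter> {u. u \<in> N w \<and> u \<in> N w'} = N w \<inter> N w'" using neighbours_subset by auto
    then show ?thesis using pair_finite_verts by (simp add: of_bool_conj[symmetric] sum_of_bool_eq)
  qed
  have "seidel u w * seidel u w' = 1 - of_bool (u = w) * 1 - of_bool (u = w') * 1
      - 2 * of_bool (u \<in> N w) - 2 * of_bool (u \<in> N w')
      + of_bool (u = w) * of_bool (u = w')
      + 2 * (of_bool (u = w) * of_bool (u \<in> N w')) + 2 * (of_bool (u = w') * of_bool (u \<in> N w))
      + 4 * (of_bool (u \<in> N w) * of_bool (u \<in> N w'))" for u
    by (simp add: seidel_def algebra_simps)
  then have "(\<Sum>u\<in>V. seidel u w * seidel u w') = of_nat n - 1 - 1 - 2 * of_nat k - 2 * of_nat k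
      + of_bool (w = w') + 2 * of_bool (w \<in> N w') + 2 * of_bool (w' \<in> N w)
      + 4 * of_nat (card (N w \<inter> N w'))"
    by (simp only: sum.distrib sum_subtractf sum_distrib_left[symmetric] sum_of_bool_eq_mult
        sum_of_bool_neighbours int w) (simp add: card_verts)
  moreover have "w \<in> N w' \<longleftrightarrow> (w, w') \<in> parcs G" "w' \<in> N w \<longleftrightarrow> (w, w') \<in> parcs G"
    using arcs_sym by (auto simp: mem_neighbours_iff)
  ultimately show ?thesis by simp
qed

text \<open>The Seidel columns have sum 0, squared norm \<open>n - 1\<close> and mutual products -1.
  A border of ones with corner 0 makes them orthogonal of squared norm \<open>n\<close>.\<close>

lemma conference_order_two_squares:
  assumes "t > 0" "n = 4 * t + 1" "k = 2 * t" "l = t - 1" "m = t"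
  shows "\<exists>a b. int n = a\<^sup>2 + b\<^sup>2"
proof -
  have col: "(\<Sum>u\<in>V. seidel u w) = 0" if "w \<in> V" for w
    using seidel_column_sum[OF that] assms by simp
  have inner: "(\<Sum>u\<in>V. seidel u w * seidel u w') = (if w = w' then of_nat n - 1 else -1)"
    if "w \<in> V" "w' \<in> V" for w w'
  proof -
    consider "w = w'" | "w \<noteq> w'" "(w, w') \<in> parcs G" | "w \<noteq> w'" "(w, w') \<notin> parcs G" by blast
    then show ?thesis
    proof cases
      case 1
      then have "(w, w') \<notin> parcs G" using not_self_neighbour by (simp add: mem_neighbours_iff)
      then show ?thesis using seidel_columns_inner[OF that] 1 that degree by simp
    next
      case 2
      \<comment> \<open>Here \<open>t > 0\<close> keeps the natural-number subtraction
        \<open>t - 1\<close> from truncating.\<close>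
      have "(of_nat l :: rat) = of_nat t - 1" using assms by (simp add: of_nat_diff)
      then show ?thesis using seidel_columns_inner[OF that] 2 common_adjacent[OF 2(2)] assms by simp
    next
      case 3
      then show ?thesis
        using seidel_columns_inner[OF that] common_nonadjacent[OF that 3] assms by simp
    qed
  qed
  obtain h where h: "bij_betw h {..<n} V"
    using ex_bij_betw_nat_finite[OF pair_finite_verts] card_verts by (auto simp: lessThan_atLeast0)
  then have hV: "h i \<in> V" if "i < n" for i using that by (auto simp: bij_betw_def)
  have reindex: "(\<Sum>i<n. f (h i)) = (\<Sum>u\<in>V. f u)" for f :: "'a \<Rightarrow> rat"
    using h by (rule sum.reindex_bij_betw)
  have h_eq: "h i = h j \<longleftrightarrow> i = j" if "i < n" "j < n" for i j
    using h that by (auto simp: bij_betw_def inj_on_def)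
  \<comment> \<open>Bordering the Seidel matrix by ones yields a conference matrix of order \<open>4t + 2\<close>.\<close>
  define C :: "nat \<Rightarrow> nat \<Rightarrow> rat" where "C i j =
    (if i < n \<and> j < n then seidel (h i) (h j) else if i < n \<or> j < n then 1 else 0)" for i j
  have orth: "(\<Sum>i<Suc n. C i j * C i j') = (if j = j' then of_nat n else 0)"
    if jj: "j < Suc n" "j' < Suc n" for j j'
  proof -
    consider "j < n" "j' < n" | "j < n" "j' = n" | "j = n" "j' < n" | "j = n" "j' = n"
      using jj by linarith
    then show ?thesis
    proof cases
      case 1
      then show ?thesis
        using inner[OF hV hV, of j j'] h_eq[of j j']
          reindex[of "\<lambda>u. seidel u (h j) * seidel u (h j')"] by (simp add: C_def)
    next
      case 2
      then show ?thesis using col[OF hV, of j] reindex[of "\<lambda>u. seidel u (h j)"] by (simp add: C_def)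
    next
      case 3
      then show ?thesis using col[OF hV, of j'] reindex[of "\<lambda>u. seidel u (h j')"] by (simp add: C_def)
    next
      case 4
      then show ?thesis by (simp add: C_def)
    qed
  qed
  \<comment> \<open>The order is 2 modulo 4, so exactly two squares survive beyond the blocks of
    four.\<close>
  have size: "4 * t + 2 = Suc n" using assms by simp
  have "(\<Sum>i<4*t+2. (\<Sum>j<4*t+2. C i j * x j)\<^sup>2) = of_nat n * (\<Sum>j<4*t+2. (x j)\<^sup>2)" for x
    unfolding size using orth by (rule orthogonal_columns_norm)
  then obtain a b :: rat where "of_nat n = a\<^sup>2 + b\<^sup>2"
    using similarity_imp_two_rational_squares[of C t "of_nat n"] four_squares_of_nat[of n] assms
    by auto
  then have "of_int (int n) = a\<^sup>2 + b\<^sup>2" by simp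
  then show ?thesis by (rule two_rational_squares_imp_two_squares)
qed

end

theorem theorem6p2:
  fixes G :: "'a pair_pre_digraph" and v k l m :: nat
  assumes "strongly_regular G v k l m"
    and "graph_iso (dist2_graph G) G"
  shows "self_complementary G \<and>
    (\<exists>t::nat. t > 0 \<and> (v, k, l, m) = (4 * t + 1, 2 * t, t - 1, t) \<and>
      (\<exists>a b :: int. int (4 * t + 1) = a\<^sup>2 + b\<^sup>2))"
proof -
  have "pair_graph G" using assms(1) by (simp add: strongly_regular_def)
  then interpret strongly_regular_graph G v k l m
    using assms(1) by (simp add: strongly_regular_graph_def strongly_regular_graph_axioms_def)
  have m: "m > 0" using assms(2) by (rule dist2_graph_iso_imp_m_pos)
  then have iso: "graph_iso (graph_complement G) G"
    using assms(2) dist2_graph_eq_complement by simp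
  interpret C: pair_graph "graph_complement G"
    using pair_finite_verts pair_sym_arcs
    by (intro pair_graph_complement) (simp_all add: symmetric_def)
  have "self_complementary G"
    unfolding self_complementary_def using iso C.pair_wf_digraph_axioms by (rule graph_iso_sym)
  moreover note params = conference_parameters[OF m iso]
  moreover have "\<exists>a b. int v = a\<^sup>2 + b\<^sup>2"
    using conference_order_two_squares[OF m] params by simp
  ultimately show ?thesis using m by auto
qed

end
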